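(* There is a universal constant $C>0$ such that the following holds. Let $0<\mu\le L$, let $f:\mathbb{R}^{d_x}\times\mathbb{R}^{d_y}\to\mathbb{R}$ belong to $S_{\mu,L}$, and let $z^*$ be its saddle point. Let $\widetilde\nabla_xf,\widetilde\nabla_yf$ be inexact partial gradients of $f$ with relative error $\alpha\in[0,1)$, where $\alpha<\frac{\mu}{L}$. Let $\varepsilon>0$ and let $z^0\ne z^*$ be a starting point. Then Inexact Sim-GDA started from $z^0$ with step sizes $\eta_x=\eta_y=\eta=\frac{\mu-\alpha L}{(1+\alpha)^2L^2}$ generates $z^N$ with $\|z^N-z^*\|_2\le\varepsilon$ in $$N=\mathcal{O}\left(\frac{L^2}{\mu^2}\,\frac{1}{(1-\alpha L/\mu)^2}\,\ln\frac{\|z^0-z^*\|_2}{\varepsilon}\right)$$ iterations; that is, $\|z^N-z^*\|_2\le\varepsilon$ for every integer $N\ge0$ with $N\ge C\,\frac{L^2}{\mu^2}\frac{1}{(1-\alpha L/\mu)^2}\ln\frac{\|z^0-z^*\|_2}{\varepsilon}$.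
   Context: The problem is $\min_{x\in\mathbb{R}^{d_x}}\max_{y\in\mathbb{R}^{d_y}}f(x,y)$. Write $z=(x,y)$ and $g(z)=(\nabla_xf(x,y),-\nabla_yf(x,y))\in\mathbb{R}^{d_x+d_y}$. $f\in S_{\mu,L}$ means: $f$ is continuously differentiable, convex in $x$ and concave in $y$, and for all $z^0,z^1\in\mathbb{R}^{d_x+d_y}$, $\langle g(z^1)-g(z^0),z^1-z^0\rangle\ge\mu\|z^1-z^0\|_2^2$ and $\|g(z^1)-g(z^0)\|_2\le L\|z^1-z^0\|_2$. The saddle point $z^*=(x^*,y^* )$ is the point with $g(z^* )=0$. Inexact partial gradients with relative error $\alpha$: maps $\widetilde\nabla_xf,\widetilde\nabla_yf$ such that for all $x,y$, $$\|\widetilde\nabla_xf(x,y)-\nabla_xf(x,y)\|_2^2+\|\widetilde\nabla_yf(x,y)-\nabla_yf(x,y)\|_2^2\le\alpha^2\left(\|\nabla_xf(x,y)\|_2^2+\|\nabla_yf(x,y)\|_2^2\right).$$ Inexact Sim-GDA with step sizes $\eta_x,\eta_y$, started from $z^0=(x^0,y^0)$: for $k=0,1,2,\dots$, $x^{k+1}=x^k-\eta_x\widetilde\nabla_xf(x^k,y^k)$, $y^{k+1}=y^k+\eta_y\widetilde\nabla_yf(x^k,y^k)$, and $z^k=(x^k,y^k)$. *)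

theory Defs
  imports "HOL-Analysis.Analysis"
begin

section \<open>The spaces \<open>\<real>\<^sup>n\<close> inside one ambient inner product space\<close>

text \<open>
  A constant that is uniform in the dimensions can only be expressed if the dimensions are
  terms, bound inside the formula, and not type parameters: from \<open>\<exists>C\<close> in a statement
  about \<open>real ^ 'n\<close> one gets a constant that may depend on \<open>'n\<close>. Therefore
  \<open>\<real>\<^sup>n\<close> is the subspace of those finitely supported real sequences whose entries
  vanish from index \<open>n\<close> on, with the standard inner product.
\<close>

typedef finseq = "{v :: nat \<Rightarrow> real. finite {i. v i \<noteq> 0}}"
  morphisms entry Abs_finseq
  by (rule exI[of _ "\<lambda>_. 0"]) simp

setup_lifting type_definition_finseq

lemma finite_support [simp]: "finite {i. entry v i \<noteq> 0}"
  using entry by auto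

instantiation finseq :: real_vector
begin

lift_definition zero_finseq :: finseq is "\<lambda>_. 0" by simp

lift_definition plus_finseq :: "finseq \<Rightarrow> finseq \<Rightarrow> finseq" is "\<lambda>u v i. u i + v i"
  subgoal for u v
    by (rule finite_subset[of _ "{i. u i \<noteq> 0} \<union> {i. v i \<noteq> 0}"]) auto
  done

lift_definition uminus_finseq :: "finseq \<Rightarrow> finseq" is "\<lambda>u i. - u i" by simp

lift_definition minus_finseq :: "finseq \<Rightarrow> finseq \<Rightarrow> finseq" is "\<lambda>u v i. u i - v i"
  subgoal for u v
    by (rule finite_subset[of _ "{i. u i \<noteq> 0} \<union> {i. v i \<noteq> 0}"]) auto
  done

lift_definition scaleR_finseq :: "real \<Rightarrow> finseq \<Rightarrow> finseq" is "\<lambda>c u i. c * u i"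
  subgoal for c u
    by (rule finite_subset[of _ "{i. u i \<noteq> 0}"]) auto
  done

instance
  by standard (transfer; simp add: fun_eq_iff algebra_simps)+

end

lemma entry_zero [simp]: "entry 0 i = 0"
  by transfer simp

lemma entry_add [simp]: "entry (u + v) i = entry u i + entry v i"
  by transfer simp

lemma entry_scaleR [simp]: "entry (c *\<^sub>R u) i = c * entry u i"
  by transfer simp

instantiation finseq :: real_inner
begin

definition inner_finseq :: "finseq \<Rightarrow> finseq \<Rightarrow> real"
  where "inner u v = (\<Sum>i | entry u i \<noteq> 0. entry u i * entry v i)"

definition norm_finseq :: "finseq \<Rightarrow> real"
  where "norm u = sqrt (inner u u)" for u :: finseq

definition dist_finseq :: "finseq \<Rightarrow> finseq \<Rightarrow> real"
  where "dist u v = norm (u - v)" for u v :: finseq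

definition sgn_finseq :: "finseq \<Rightarrow> finseq"
  where "sgn u = u /\<^sub>R norm u" for u :: finseq

definition uniformity_finseq :: "(finseq \<times> finseq) filter"
  where "uniformity = (INF e\<in>{0<..}. principal {(u, v :: finseq). dist u v < e})"

definition open_finseq :: "finseq set \<Rightarrow> bool"
  where "open U \<longleftrightarrow> (\<forall>u\<in>U. \<forall>\<^sub>F (u', v) in uniformity. u' = u \<longrightarrow> v \<in> U)" for U :: "finseq set"

lemma inner_finseq_superset:
  assumes "finite A" "{i. entry u i \<noteq> 0} \<subseteq> A"
  shows "inner u v = (\<Sum>i\<in>A. entry u i * entry v i)"
  unfolding inner_finseq_def using assms by (intro sum.mono_neutral_left) auto

instance
proof
  fix u v w :: finseq and c :: real
  define A where "A = {i. entry u i \<noteq> 0} \<union> {i. entry v i \<noteq> 0} \<union> {i. entry w i \<noteq> 0}"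
  have A: "finite A"
    by (simp add: A_def)
  have in_A: "inner x y = (\<Sum>i\<in>A. entry x i * entry y i)"
    if "\<And>i. i \<notin> A \<Longrightarrow> entry x i = 0" for x y
    using that by (intro inner_finseq_superset A) auto
  have u: "entry u i = 0" and v: "entry v i = 0" if "i \<notin> A" for i
    using that by (auto simp: A_def)
  show "dist u v = norm (u - v)"
    by (rule dist_finseq_def)
  show "sgn u = u /\<^sub>R norm u"
    by (rule sgn_finseq_def)
  show "(uniformity :: (finseq \<times> finseq) filter)
      = (INF e\<in>{0<..}. principal {(u, v). dist u v < e})"
    by (rule uniformity_finseq_def)
  show "open U \<longleftrightarrow> (\<forall>u\<in>U. \<forall>\<^sub>F (u', v) in uniformity. u' = u \<longrightarrow> v \<in> U)"
    for U :: "finseq set"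
    by (rule open_finseq_def)
  show "norm u = sqrt (inner u u)"
    by (rule norm_finseq_def)
  show "inner u v = inner v u"
    by (simp add: in_A u v mult.commute)
  show "inner (u + v) w = inner u w + inner v w"
    by (simp add: in_A u v distrib_right sum.distrib)
  show "inner (c *\<^sub>R u) v = c * inner u v"
    by (simp add: in_A u sum_distrib_left mult.assoc)
  show "0 \<le> inner u u"
    by (simp add: inner_finseq_def sum_nonneg)
  have "inner u u = 0 \<longleftrightarrow> (\<forall>i. entry u i = 0)"
    by (auto simp: inner_finseq_def sum_nonneg_eq_0_iff)
  then show "inner u u = 0 \<longleftrightarrow> u = 0"
    by (simp add: entry_inject[symmetric] fun_eq_iff)
qed

end

definition Rn :: "nat \<Rightarrow> finseq set"
  where "Rn n = {v. \<forall>i\<ge>n. entry v i = 0}"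

lemma subspace_Rn: "subspace (Rn n)"
  by (simp add: Rn_def subspace_def)

lemma inner_Rn:
  assumes "u \<in> Rn n"
  shows "inner u v = (\<Sum>i<n. entry u i * entry v i)"
  using assms by (intro inner_finseq_superset) (auto simp: Rn_def intro: ccontr)

lemma norm_Rn: "u \<in> Rn n \<Longrightarrow> norm u = L2_set (entry u) {..<n}"
  by (simp add: norm_eq_sqrt_inner inner_Rn L2_set_def power2_eq_square)

lemma bij_betw_entry_Rn: "bij_betw entry (Rn n) {v. \<forall>i\<ge>n. v i = 0}"
proof (rule bij_betw_byWitness[where f' = Abs_finseq])
  have fin: "finite {i. v i \<noteq> 0}" if "\<forall>i\<ge>n. v i = 0" for v :: "nat \<Rightarrow> real"
  proof (rule finite_subset)
    show "{i. v i \<noteq> 0} \<subseteq> {..<n}"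
      using that by (metis (mono_tags, lifting) lessThan_iff mem_Collect_eq not_le subsetI)
  qed simp
  show "\<forall>u\<in>Rn n. Abs_finseq (entry u) = u"
    by (simp add: entry_inverse)
  show "\<forall>v\<in>{v. \<forall>i\<ge>n. v i = 0}. entry (Abs_finseq v) = v"
    using fin by (simp add: Abs_finseq_inverse)
  show "entry ` Rn n \<subseteq> {v. \<forall>i\<ge>n. v i = 0}"
    by (auto simp: Rn_def)
  show "Abs_finseq ` {v. \<forall>i\<ge>n. v i = 0} \<subseteq> Rn n"
    using fin by (auto simp: Rn_def Abs_finseq_inverse)
qed


section \<open>Gradients relative to a subspace\<close>

text \<open>
  The gradient at \<open>x\<close> of the restriction of \<open>h\<close> to the subspace \<open>S\<close>. The condition
  \<open>D \<in> S\<close> makes it unique.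
\<close>

definition grad :: "'a::real_inner set \<Rightarrow> ('a \<Rightarrow> real) \<Rightarrow> 'a \<Rightarrow> 'a"
  where "grad S h x = (THE D. D \<in> S \<and> (h has_derivative (\<lambda>v. inner v D)) (at x within S))"

lemma grad_eqI:
  assumes S: "subspace S" and x: "x \<in> S" and D: "D \<in> S"
    and der: "(h has_derivative (\<lambda>v. inner v D)) (at x within S)"
  shows "grad S h x = D"
  unfolding grad_def
proof (rule the_equality)
  show "D \<in> S \<and> (h has_derivative (\<lambda>v. inner v D)) (at x within S)"
    using D der by blast
next
  fix E assume E: "E \<in> S \<and> (h has_derivative (\<lambda>v. inner v E)) (at x within S)"
  define e where "e = E - D"
  have e: "x + t *\<^sub>R e \<in> S" for t
    using S x D E by (simp add: e_def subspace_add subspace_diff subspace_scale)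
  have line: "((\<lambda>t. h (x + t *\<^sub>R e)) has_derivative (\<lambda>t. inner (t *\<^sub>R e) F)) (at 0)"
    if "(h has_derivative (\<lambda>v. inner v F)) (at x within S)" for F
  proof -
    have "((\<lambda>t. x + t *\<^sub>R e) has_derivative (\<lambda>t. t *\<^sub>R e)) (at 0)"
      by (auto intro!: derivative_eq_intros)
    moreover have "(h has_derivative (\<lambda>v. inner v F))
        (at (x + 0 *\<^sub>R e) within range (\<lambda>t. x + t *\<^sub>R e))"
      using e has_derivative_subset[OF that] by (simp add: image_subset_iff)
    ultimately show ?thesis
      by (rule has_derivative_in_compose)
  qed
  have "(\<lambda>t. inner (t *\<^sub>R e) D) = (\<lambda>t. inner (t *\<^sub>R e) E)"
    using has_derivative_unique[OF line line] der E by blast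
  then have "inner (1 *\<^sub>R e) D = inner (1 *\<^sub>R e) E"
    by meson
  then have "inner e e = 0"
    by (simp add: e_def inner_diff_right inner_commute)
  then show "E = D"
    by (simp add: e_def)
qed

definition continuously_differentiable_on :: "('a::real_inner \<Rightarrow> real) \<Rightarrow> 'a set \<Rightarrow> bool"
    (infix \<open>continuously'_differentiable'_on\<close> 50)
  where "h continuously_differentiable_on S \<longleftrightarrow>
    (\<exists>G. (\<forall>x\<in>S. G x \<in> S \<and> (h has_derivative (\<lambda>v. inner v (G x))) (at x within S))
       \<and> continuous_on S G)"


section \<open>Saddle point problems and Sim-GDA\<close>

text \<open>
  \<open>X\<close> and \<open>Y\<close> are the spaces of the two variables. Values of \<open>f\<close> outside \<open>X \<times> Y\<close> are
  irrelevant. Inner product and norm on pairs are the Euclidean ones of the product type.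
\<close>

definition grad_x :: "'a::real_inner set \<Rightarrow> ('a \<times> 'b::real_inner \<Rightarrow> real) \<Rightarrow> 'a \<Rightarrow> 'b \<Rightarrow> 'a"
  where "grad_x X f x y = grad X (\<lambda>u. f (u, y)) x"

definition grad_y :: "'b::real_inner set \<Rightarrow> ('a::real_inner \<times> 'b \<Rightarrow> real) \<Rightarrow> 'a \<Rightarrow> 'b \<Rightarrow> 'b"
  where "grad_y Y f x y = grad Y (\<lambda>v. f (x, v)) y"

definition saddle_op ::
    "'a::real_inner set \<Rightarrow> 'b::real_inner set \<Rightarrow> ('a \<times> 'b \<Rightarrow> real) \<Rightarrow> 'a \<times> 'b \<Rightarrow> 'a \<times> 'b"
  where "saddle_op X Y f = (\<lambda>(x, y). (grad_x X f x y, - grad_y Y f x y))"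

definition saddle_class ::
    "'a::real_inner set \<Rightarrow> 'b::real_inner set \<Rightarrow> real \<Rightarrow> real \<Rightarrow> ('a \<times> 'b \<Rightarrow> real) set"
  where "saddle_class X Y \<mu> L = {f.
    f continuously_differentiable_on (X \<times> Y) \<and>
    (\<forall>y\<in>Y. convex_on X (\<lambda>x. f (x, y))) \<and>
    (\<forall>x\<in>X. concave_on Y (\<lambda>y. f (x, y))) \<and>
    (\<forall>z0\<in>X \<times> Y. \<forall>z1\<in>X \<times> Y.
       inner (saddle_op X Y f z1 - saddle_op X Y f z0) (z1 - z0) \<ge> \<mu> * (norm (z1 - z0))\<^sup>2 \<and>
       norm (saddle_op X Y f z1 - saddle_op X Y f z0) \<le> L * norm (z1 - z0))}"

definition inexact_partial_gradients ::
    "'a::real_inner set \<Rightarrow> 'b::real_inner set \<Rightarrow> real \<Rightarrow> ('a \<times> 'b \<Rightarrow> real) \<Rightarrow>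
     ('a \<Rightarrow> 'b \<Rightarrow> 'a) \<Rightarrow> ('a \<Rightarrow> 'b \<Rightarrow> 'b) \<Rightarrow> bool"
  where "inexact_partial_gradients X Y \<alpha> f gx gy \<longleftrightarrow>
    (\<forall>x\<in>X. \<forall>y\<in>Y. gx x y \<in> X \<and> gy x y \<in> Y \<and>
       (norm (gx x y - grad_x X f x y))\<^sup>2 + (norm (gy x y - grad_y Y f x y))\<^sup>2
         \<le> \<alpha>\<^sup>2 * ((norm (grad_x X f x y))\<^sup>2 + (norm (grad_y Y f x y))\<^sup>2))"

primrec sim_gda ::
    "('a::real_vector \<Rightarrow> 'b::real_vector \<Rightarrow> 'a) \<Rightarrow> ('a \<Rightarrow> 'b \<Rightarrow> 'b) \<Rightarrow> real \<Rightarrow> real \<Rightarrow>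
     'a \<times> 'b \<Rightarrow> nat \<Rightarrow> 'a \<times> 'b"
  where
    "sim_gda gx gy \<eta>x \<eta>y z0 0 = z0"
  | "sim_gda gx gy \<eta>x \<eta>y z0 (Suc k) =
       (let (x, y) = sim_gda gx gy \<eta>x \<eta>y z0 k
        in (x - \<eta>x *\<^sub>R gx x y, y + \<eta>y *\<^sub>R gy x y))"

text \<open>
  On a continuously differentiable \<open>f\<close>, the partial gradients are the two components of the
  full gradient.
\<close>

lemma grad_x_grad_y_eqI:
  assumes X: "subspace X" and Y: "subspace Y" and xy: "x \<in> X" "y \<in> Y" and ab: "a \<in> X" "b \<in> Y"
    and der: "(f has_derivative (\<lambda>v. inner v (a, b))) (at (x, y) within X \<times> Y)"
  shows "grad_x X f x y = a" "grad_y Y f x y = b"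
proof -
  have dx: "((\<lambda>u. (u, y)) has_derivative (\<lambda>u. (u, 0))) (at x within X)"
    by (auto intro!: derivative_eq_intros)
  have "(f has_derivative (\<lambda>v. inner v (a, b))) (at (x, y) within (\<lambda>u. (u, y)) ` X)"
    using xy by (intro has_derivative_subset[OF der]) auto
  from has_derivative_in_compose[OF dx this]
  have "((\<lambda>u. f (u, y)) has_derivative (\<lambda>u. inner u a)) (at x within X)"
    by simp
  then show "grad_x X f x y = a"
    unfolding grad_x_def using X xy ab by (intro grad_eqI)
  have dy: "((\<lambda>v. (x, v)) has_derivative (\<lambda>v. (0, v))) (at y within Y)"
    by (auto intro!: derivative_eq_intros)
  have "(f has_derivative (\<lambda>v. inner v (a, b))) (at (x, y) within (\<lambda>v. (x, v)) ` Y)"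
    using xy by (intro has_derivative_subset[OF der]) auto
  from has_derivative_in_compose[OF dy this]
  have "((\<lambda>v. f (x, v)) has_derivative (\<lambda>v. inner v b)) (at y within Y)"
    by simp
  then show "grad_y Y f x y = b"
    unfolding grad_y_def using Y xy ab by (intro grad_eqI)
qed

end

theory Submission
  imports Defs
begin

text \<open>
  Let \<open>g = saddle_op X Y f\<close> and let \<open>w\<close> be its inexact version. As \<open>g\<close> vanishes at the saddle
  point \<open>z\<^sup>*\<close>, the error of \<open>w\<close> at \<open>z\<close> is at most \<open>\<alpha> * L * norm (z - z\<^sup>*)\<close>. Hence
  \<open>w\<close> is still strongly monotone towards \<open>z\<^sup>*\<close>, with constant \<open>\<mu> - \<alpha> * L\<close>, and grows linearly,
  with constant \<open>(1 + \<alpha>) * L\<close>. The step size minimises the resulting quadratic bound for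
  the squared distance to \<open>z\<^sup>*\<close> and contracts it by the factor
  \<open>1 - ((\<mu> - \<alpha> * L) / ((1 + \<alpha>) * L))\<^sup>2\<close>.
\<close>

text \<open>Expanding the square and inserting \<open>mono\<close> and \<open>growth\<close> bounds
  the left side by \<open>1 - 2 * \<eta> * c + \<eta>\<^sup>2 * s\<^sup>2\<close> times the squared
  norm of \<open>d\<close>; this quadratic in \<eta> is smallest at
  \<open>c / s\<^sup>2\<close>.\<close>

lemma monotone_step_contraction:
  fixes d w :: "'a::real_inner"
  assumes mono: "c * (norm d)\<^sup>2 \<le> inner w d" and growth: "norm w \<le> s * norm d"
    and "0 \<le> c" "0 < s"
  shows "(norm (d - (c / s\<^sup>2) *\<^sub>R w))\<^sup>2 \<le> (1 - (c / s)\<^sup>2) * (norm d)\<^sup>2"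
proof -
  define \<eta> where "\<eta> = c / s\<^sup>2"
  have "0 \<le> \<eta>"
    using assms by (simp add: \<eta>_def)
  have "(norm w)\<^sup>2 \<le> s\<^sup>2 * (norm d)\<^sup>2"
    using power_mono[OF growth norm_ge_zero, of 2] by (simp add: power_mult_distrib)
  then have "\<eta>\<^sup>2 * (norm w)\<^sup>2 \<le> \<eta>\<^sup>2 * (s\<^sup>2 * (norm d)\<^sup>2)"
    by (intro mult_left_mono) auto
  moreover have "\<eta> * (c * (norm d)\<^sup>2) \<le> \<eta> * inner w d"
    using mono \<open>0 \<le> \<eta>\<close> by (intro mult_left_mono)
  moreover have "(norm (d - \<eta> *\<^sub>R w))\<^sup>2 = (norm d)\<^sup>2 - 2 * (\<eta> * inner w d) + \<eta>\<^sup>2 * (norm w)\<^sup>2"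
    unfolding power2_norm_eq_inner
    by (simp add: inner_diff_left inner_diff_right inner_commute power2_eq_square)
  \<comment> \<open>At this step size the quadratic term cancels exactly half of the linear
    gain.\<close>
  moreover have "\<eta> * c = (c / s)\<^sup>2" "\<eta>\<^sup>2 * s\<^sup>2 = (c / s)\<^sup>2"
    using \<open>0 < s\<close> by (simp_all add: \<eta>_def power2_eq_square field_simps)
  then have "\<eta> * (c * (norm d)\<^sup>2) = (c / s)\<^sup>2 * (norm d)\<^sup>2"
    "\<eta>\<^sup>2 * (s\<^sup>2 * (norm d)\<^sup>2) = (c / s)\<^sup>2 * (norm d)\<^sup>2"
    by (simp_all only: mult.assoc[symmetric])
  ultimately show ?thesis
    unfolding \<eta>_def[symmetric] by (simp add: algebra_simps)
qed

text \<open>The conditions on \<open>f\<close>, \<open>gx\<close> and \<open>gy\<close> are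
  available only on \<open>X \<times> Y\<close>, so each iterate must be known to lie there.\<close>

lemma sim_gda_in_subspace:
  assumes X: "subspace X" and Y: "subspace Y"
    and inexact: "inexact_partial_gradients X Y \<alpha> f gx gy"
    and z0: "z0 \<in> X \<times> Y"
  shows "sim_gda gx gy \<eta>x \<eta>y z0 k \<in> X \<times> Y"
proof (induction k)
  case 0
  then show ?case
    using z0 by simp
next
  case (Suc k)
  then obtain x y where "sim_gda gx gy \<eta>x \<eta>y z0 k = (x, y)" "x \<in> X" "y \<in> Y"
    by auto
  moreover have "gx x y \<in> X" "gy x y \<in> Y"
    using inexact calculation by (auto simp: inexact_partial_gradients_def)
  ultimately show ?case
    using X Y by (simp add: subspace_diff subspace_add subspace_scale)
qed

text \<open>By Pythagoras on the product space, the summed relative error condition is the square of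
  this bound; the sign flip of the second component leaves norms unchanged.\<close>

lemma inexact_saddle_op_error:
  assumes inexact: "inexact_partial_gradients X Y \<alpha> f gx gy" and "0 \<le> \<alpha>"
    and z: "x \<in> X" "y \<in> Y"
  shows "norm ((gx x y, - gy x y) - saddle_op X Y f (x, y)) \<le> \<alpha> * norm (saddle_op X Y f (x, y))"
proof (rule power2_le_imp_le)
  have "(norm (gx x y - grad_x X f x y))\<^sup>2 + (norm (gy x y - grad_y Y f x y))\<^sup>2
      \<le> \<alpha>\<^sup>2 * ((norm (grad_x X f x y))\<^sup>2 + (norm (grad_y Y f x y))\<^sup>2)"
    using inexact z by (simp add: inexact_partial_gradients_def)
  moreover have "norm (grad_y Y f x y - gy x y) = norm (gy x y - grad_y Y f x y)"
    by (rule norm_minus_commute)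
  ultimately show "(norm ((gx x y, - gy x y) - saddle_op X Y f (x, y)))\<^sup>2
      \<le> (\<alpha> * norm (saddle_op X Y f (x, y)))\<^sup>2"
    by (simp add: saddle_op_def norm_Pair power_mult_distrib)
qed (use \<open>0 \<le> \<alpha>\<close> in simp)

lemma sim_gda_contraction:
  assumes X: "subspace X" and Y: "subspace Y"
    and "0 < L" "0 \<le> \<alpha>" "\<alpha> * L \<le> \<mu>"
    and f: "f \<in> saddle_class X Y \<mu> L"
    and zs: "zs \<in> X \<times> Y" "saddle_op X Y f zs = 0"
    and inexact: "inexact_partial_gradients X Y \<alpha> f gx gy"
    and z0: "z0 \<in> X \<times> Y"
    and \<eta>: "\<eta> = (\<mu> - \<alpha> * L) / ((1 + \<alpha>)\<^sup>2 * L\<^sup>2)"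
  shows "(norm (sim_gda gx gy \<eta> \<eta> z0 (Suc k) - zs))\<^sup>2
    \<le> (1 - ((\<mu> - \<alpha> * L) / ((1 + \<alpha>) * L))\<^sup>2) * (norm (sim_gda gx gy \<eta> \<eta> z0 k - zs))\<^sup>2"
proof -
  obtain x y where xy: "sim_gda gx gy \<eta> \<eta> z0 k = (x, y)"
    by fastforce
  then have z: "(x, y) \<in> X \<times> Y"
    using sim_gda_in_subspace[OF X Y inexact z0, of \<eta> \<eta> k] by simp
  define d where "d = (x, y) - zs"
  define g where "g = saddle_op X Y f (x, y)"
  define w where "w = (gx x y, - gy x y)"
  have "\<forall>z0\<in>X \<times> Y. \<forall>z1\<in>X \<times> Y.
      inner (saddle_op X Y f z1 - saddle_op X Y f z0) (z1 - z0) \<ge> \<mu> * (norm (z1 - z0))\<^sup>2 \<and>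
      norm (saddle_op X Y f z1 - saddle_op X Y f z0) \<le> L * norm (z1 - z0)"
    using f unfolding saddle_class_def by blast
  \<comment> \<open>Comparing with \<open>zs\<close>, where the operator vanishes, turns differences
    of operator values into \<open>g\<close> itself.\<close>
  from bspec[OF bspec[OF this zs(1)] z]
  have mono: "\<mu> * (norm d)\<^sup>2 \<le> inner g d" and lip: "norm g \<le> L * norm d"
    by (simp_all only: zs(2) d_def g_def diff_zero)
  have "norm (w - g) \<le> \<alpha> * norm g"
    using inexact_saddle_op_error[OF inexact \<open>0 \<le> \<alpha>\<close>] z by (simp add: w_def g_def)
  also have "\<dots> \<le> \<alpha> * (L * norm d)"
    using lip \<open>0 \<le> \<alpha>\<close> by (rule mult_left_mono)
  finally have err: "norm (w - g) \<le> \<alpha> * L * norm d"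
    by simp
  \<comment> \<open>The error can thus lower the monotonicity constant \<mu> by at most
    \<open>\<alpha> * L\<close>.\<close>
  have "\<bar>inner (w - g) d\<bar> \<le> norm (w - g) * norm d"
    by (rule Cauchy_Schwarz_ineq2)
  also have "\<dots> \<le> \<alpha> * L * norm d * norm d"
    using err by (rule mult_right_mono) simp
  finally have "(\<mu> - \<alpha> * L) * (norm d)\<^sup>2 \<le> inner w d"
    using mono by (simp add: inner_diff_left power2_eq_square algebra_simps)
  moreover have "norm w \<le> (1 + \<alpha>) * L * norm d"
    using norm_triangle_ineq[of g "w - g"] lip err by (simp add: algebra_simps)
  ultimately have "(norm (d - ((\<mu> - \<alpha> * L) / ((1 + \<alpha>) * L)\<^sup>2) *\<^sub>R w))\<^sup>2
      \<le> (1 - ((\<mu> - \<alpha> * L) / ((1 + \<alpha>) * L))\<^sup>2) * (norm d)\<^sup>2"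
    using \<open>0 < L\<close> \<open>0 \<le> \<alpha>\<close> \<open>\<alpha> * L \<le> \<mu>\<close> by (intro monotone_step_contraction) auto
  \<comment> \<open>Equal step sizes and the minus sign in \<open>w\<close> merge descent in
    \<open>x\<close> and ascent in \<open>y\<close> into one step along \<open>- w\<close>.\<close>
  moreover have "sim_gda gx gy \<eta> \<eta> z0 (Suc k) - zs = d - \<eta> *\<^sub>R w"
    by (cases zs) (simp add: xy d_def w_def)
  moreover have "sim_gda gx gy \<eta> \<eta> z0 k - zs = d"
    by (simp only: xy d_def)
  moreover have "\<eta> = (\<mu> - \<alpha> * L) / ((1 + \<alpha>) * L)\<^sup>2"
    by (simp only: \<eta> power_mult_distrib)
  ultimately show ?thesis
    by (simp only:)
qed

text \<open>Since \<open>1 - p \<le> exp (- p)\<close>, the squares decay like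
  \<open>exp (- p * real N)\<close>. They must shrink by the square of
  \<open>\<epsilon> / r 0\<close>, whence the factor 2 in the bound on \<open>N\<close>.\<close>

lemma geometric_decay_reaches:
  fixes r :: "nat \<Rightarrow> real"
  assumes step: "\<And>k. (r (Suc k))\<^sup>2 \<le> (1 - p) * (r k)\<^sup>2"
    and "0 < p" "0 < r 0" "0 < \<epsilon>"
    and N: "2 / p * ln (r 0 / \<epsilon>) \<le> real N"
  shows "r N \<le> \<epsilon>"
proof (rule power2_le_imp_le)
  have "(r k)\<^sup>2 \<le> exp (- p * real k) * (r 0)\<^sup>2" for k
  proof (induction k)
    case (Suc k)
    have "(r (Suc k))\<^sup>2 \<le> (1 - p) * (r k)\<^sup>2"
      by (rule step)
    also have "\<dots> \<le> exp (- p) * (r k)\<^sup>2"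
      using exp_ge_add_one_self[of "- p"] by (intro mult_right_mono) auto
    also have "\<dots> \<le> exp (- p) * (exp (- p * real k) * (r 0)\<^sup>2)"
      using Suc.IH by (intro mult_left_mono) auto
    also have "\<dots> = exp (- p * real (Suc k)) * (r 0)\<^sup>2"
      by (simp add: exp_add[symmetric] mult.assoc[symmetric] algebra_simps)
    finally show ?case .
  qed simp
  then have "(r N)\<^sup>2 \<le> exp (- p * real N) * (r 0)\<^sup>2" .
  also have "\<dots> \<le> exp (- (2 * ln (r 0 / \<epsilon>))) * (r 0)\<^sup>2"
    using N \<open>0 < p\<close> by (intro mult_right_mono) (auto simp: field_simps)
  also have "exp (- (2 * ln (r 0 / \<epsilon>))) = (\<epsilon> / r 0)\<^sup>2"
    using \<open>0 < r 0\<close> \<open>0 < \<epsilon>\<close> by (simp add: exp_minus exp_double power_divide)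
  also have "(\<epsilon> / r 0)\<^sup>2 * (r 0)\<^sup>2 = \<epsilon>\<^sup>2"
    using \<open>0 < r 0\<close> by (simp add: power_divide)
  finally show "(r N)\<^sup>2 \<le> \<epsilon>\<^sup>2" .
qed (use \<open>0 < \<epsilon>\<close> in simp)

theorem theorem8:
  shows "\<exists>C>0. \<forall>(dx::nat) (dy::nat) (\<mu>::real) (L::real) (\<alpha>::real) (\<epsilon>::real)
           (f :: finseq \<times> finseq \<Rightarrow> real) gx gy zs z0.
    0 < \<mu> \<longrightarrow> \<mu> \<le> L \<longrightarrow>
    f \<in> saddle_class (Rn dx) (Rn dy) \<mu> L \<longrightarrow>
    zs \<in> Rn dx \<times> Rn dy \<longrightarrow> saddle_op (Rn dx) (Rn dy) f zs = 0 \<longrightarrow>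
    0 \<le> \<alpha> \<longrightarrow> \<alpha> < 1 \<longrightarrow> \<alpha> < \<mu> / L \<longrightarrow>
    inexact_partial_gradients (Rn dx) (Rn dy) \<alpha> f gx gy \<longrightarrow>
    0 < \<epsilon> \<longrightarrow>
    z0 \<in> Rn dx \<times> Rn dy \<longrightarrow> z0 \<noteq> zs \<longrightarrow>
    (let \<eta> = (\<mu> - \<alpha> * L) / ((1 + \<alpha>)\<^sup>2 * L\<^sup>2) in
      \<forall>N::nat. real N \<ge> C * (L\<^sup>2 / \<mu>\<^sup>2) * (1 / (1 - \<alpha> * L / \<mu>)\<^sup>2) * ln (norm (z0 - zs) / \<epsilon>)
        \<longrightarrow> norm (sim_gda gx gy \<eta> \<eta> z0 N - zs) \<le> \<epsilon>)"
\<comment> \<open>The constant is 8 = 2 * 4: the 2 comes from measuring decay in squared distances,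
  the 4 from bounding \<open>(1 + \<alpha>)\<^sup>2\<close>.\<close>
proof (intro exI[of _ 8] conjI allI impI, goal_cases)
  case 1
  show ?case by simp
next
  case (2 dx dy \<mu> L \<alpha> \<epsilon> f gx gy zs z0)
  note hyps = this
  define \<eta> where "\<eta> = (\<mu> - \<alpha> * L) / ((1 + \<alpha>)\<^sup>2 * L\<^sup>2)"
  define p where "p = ((\<mu> - \<alpha> * L) / (2 * L))\<^sup>2"
  have "0 < L"
    using hyps by linarith
  then have gap: "\<alpha> * L < \<mu>"
    using hyps by (simp add: field_simps)
  have "0 < p"
    using gap \<open>0 < L\<close> by (simp add: p_def)
  \<comment> \<open>Since \<open>\<alpha> < 1\<close>, replacing \<open>1 + \<alpha>\<close> by \<open>2\<close> costs only a constant factor.\<close>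
  have "(\<mu> - \<alpha> * L) / (2 * L) \<le> (\<mu> - \<alpha> * L) / ((1 + \<alpha>) * L)"
    using gap \<open>0 < L\<close> hyps by (intro divide_left_mono) auto
  then have p_le: "p \<le> ((\<mu> - \<alpha> * L) / ((1 + \<alpha>) * L))\<^sup>2"
    unfolding p_def using gap \<open>0 < L\<close> by (intro power_mono) auto
  have step: "(norm (sim_gda gx gy \<eta> \<eta> z0 (Suc k) - zs))\<^sup>2
      \<le> (1 - p) * (norm (sim_gda gx gy \<eta> \<eta> z0 k - zs))\<^sup>2" for k
  proof -
    have "(norm (sim_gda gx gy \<eta> \<eta> z0 (Suc k) - zs))\<^sup>2
        \<le> (1 - ((\<mu> - \<alpha> * L) / ((1 + \<alpha>) * L))\<^sup>2) * (norm (sim_gda gx gy \<eta> \<eta> z0 k - zs))\<^sup>2"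
      using hyps \<open>0 < L\<close> gap \<eta>_def
      by (intro sim_gda_contraction[of "Rn dx" "Rn dy" L \<alpha> \<mu> f]) (auto simp: subspace_Rn)
    also have "\<dots> \<le> (1 - p) * (norm (sim_gda gx gy \<eta> \<eta> z0 k - zs))\<^sup>2"
      using p_le by (intro mult_right_mono) auto
    finally show ?thesis .
  qed
  \<comment> \<open>In this form the powers of \<mu> in the iteration bound cancel, leaving a
    multiple of \<open>1 / p\<close>.\<close>
  have "1 - \<alpha> * L / \<mu> = (\<mu> - \<alpha> * L) / \<mu>"
    using hyps by (simp add: field_simps)
  then have rate: "8 * (L\<^sup>2 / \<mu>\<^sup>2) * (1 / (1 - \<alpha> * L / \<mu>)\<^sup>2) = 2 / p"
    using hyps by (simp add: p_def power_divide power_mult_distrib)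
  show ?case
    unfolding Let_def \<eta>_def[symmetric] rate
  proof (intro allI impI)
    fix N :: nat
    assume "2 / p * ln (norm (z0 - zs) / \<epsilon>) \<le> real N"
    then show "norm (sim_gda gx gy \<eta> \<eta> z0 N - zs) \<le> \<epsilon>"
      using hyps \<open>0 < p\<close>
      by (intro geometric_decay_reaches[of "\<lambda>k. norm (sim_gda gx gy \<eta> \<eta> z0 k - zs)" p, OF step])
        auto
  qed
qed

end
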